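(* Consider the initial value problem $$\psi_{rr}(r,t)-\psi_{tt}(r,t)+r\,\psi(r,t)=0,\qquad \psi(0,t)=e^{it},\qquad \psi_r(0,t)=0 .$$ Let $\psi_0(r,t)=e^{it}$ and, for $n\ge 0$, let $\psi_{n+1}$ be determined from $\psi_n$ by $$\psi_{n+1}(r,t)=e^{it}\Big(1-\frac{r^3}{2}\Big)+\int_0^r (s-r)^2\psi_n(s,t)\,ds-\int_0^r\frac{rs}{6}(s-r)^3\psi_n(s,t)\,ds-\int_0^r\lambda(s,r)\,\partial_{tt}\psi_{n}(s,t)\,ds,$$ where $\lambda(s,r)=(s-r)-\frac{r}{6}(s-r)^3$. Then for every $R>0$ and every $t\in\mathbb{R}$, the sequence $\psi_n(\cdot,t)$ converges uniformly on $[-R,R]$ to $\psi(\cdot,t)$, where $\psi$ is the solution of the initial value problem.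
   Context: Here $r$ and $t$ are real variables, $i$ is the imaginary unit, functions are complex valued, and subscripts denote partial derivatives. The solution $\psi$ of the initial value problem is the power series solution $$\psi(r,t)=e^{it}\sum_{k=0}^\infty \alpha_k r^k,$$ where $\alpha_0=1$, $\alpha_1=0$, $\alpha_2=-\tfrac12$ and $\alpha_{k+2}=-\dfrac{\alpha_k+\alpha_{k-1}}{(k+1)(k+2)}$ for $k\ge 1$. *)

theory Defs
  imports "HOL-Analysis.Analysis"
begin

definition partial_r :: "(real \<Rightarrow> real \<Rightarrow> complex) \<Rightarrow> real \<Rightarrow> real \<Rightarrow> complex" where
  "partial_r f r t = vector_derivative (\<lambda>x. f x t) (at r)"

definition partial_t :: "(real \<Rightarrow> real \<Rightarrow> complex) \<Rightarrow> real \<Rightarrow> real \<Rightarrow> complex" where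
  "partial_t f r t = vector_derivative (\<lambda>x. f r x) (at t)"

text \<open>Since \<^const>\<open>vector_derivative\<close> is total, a solution is explicitly required to possess the
  partial derivatives that occur in the equation.\<close>

definition solves_ivp :: "(real \<Rightarrow> real \<Rightarrow> complex) \<Rightarrow> bool" where
  "solves_ivp f \<longleftrightarrow>
     (\<forall>r t. (\<lambda>x. f x t) differentiable (at r) \<and>
            (\<lambda>x. partial_r f x t) differentiable (at r) \<and>
            (\<lambda>x. f r x) differentiable (at t) \<and>
            (\<lambda>x. partial_t f r x) differentiable (at t)) \<and>
     (\<forall>r t. partial_r (partial_r f) r t - partial_t (partial_t f) r t
              + complex_of_real r * f r t = 0) \<and>
     (\<forall>t. f 0 t = exp (\<i> * complex_of_real t)) \<and>
     (\<forall>t. partial_r f 0 t = 0)"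

text \<open>The last equation is the recursion
  \<open>\<alpha>\<^sub>j\<^sub>+\<^sub>2 = - (\<alpha>\<^sub>j + \<alpha>\<^sub>j\<^sub>-\<^sub>1) / ((j + 1) (j + 2))\<close>, \<open>j \<ge> 1\<close>, with \<open>j = k + 1\<close>.\<close>

fun alpha :: "nat \<Rightarrow> real" where
  "alpha 0 = 1"
| "alpha (Suc 0) = 0"
| "alpha (Suc (Suc 0)) = - 1 / 2"
| "alpha (Suc (Suc (Suc k))) =
     - (alpha (Suc k) + alpha k) / ((real k + 2) * (real k + 3))"

definition psi :: "real \<Rightarrow> real \<Rightarrow> complex" where
  "psi r t = exp (\<i> * complex_of_real t) * (\<Sum>k. complex_of_real (alpha k * r ^ k))"

definition lam :: "real \<Rightarrow> real \<Rightarrow> real" where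
  "lam s r = (s - r) - r / 6 * (s - r) ^ 3"

text \<open>The integrals \<open>LBINT s=0..r\<close> are oriented: for \<open>r < 0\<close> they equal \<open>- (LBINT s=r..0)\<close>.\<close>

primrec psi_iter :: "nat \<Rightarrow> real \<Rightarrow> real \<Rightarrow> complex" where
  "psi_iter 0 = (\<lambda>r t. exp (\<i> * complex_of_real t))"
| "psi_iter (Suc n) = (\<lambda>r t.
     exp (\<i> * complex_of_real t) * complex_of_real (1 - r ^ 3 / 2)
     + (LBINT s=ereal 0..ereal r. complex_of_real ((s - r) ^ 2) * psi_iter n s t)
     - (LBINT s=ereal 0..ereal r. complex_of_real (r * s / 6 * (s - r) ^ 3) * psi_iter n s t)
     - (LBINT s=ereal 0..ereal r. complex_of_real (lam s r)
          * partial_t (partial_t (psi_iter n)) s t))"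

end

theory Submission
  imports Defs
begin

text \<open>
  Separating the factor \<open>e\<^sup>i\<^sup>t\<close> turns both claims into statements about functions of \<open>r\<close> alone.
  The coefficients \<open>alpha\<close> define an entire series \<open>psi_radial\<close> with
  \<open>f'' = - (1 + r) f\<close>, \<open>f 0 = 1\<close>, \<open>f' 0 = 0\<close>, so \<^const>\<open>psi\<close> solves the initial value problem.

  Since \<open>\<partial>\<^sub>t\<^sub>t e\<^sup>i\<^sup>t = - e\<^sup>i\<^sup>t\<close>, the iteration is \<open>e\<^sup>i\<^sup>t\<close> times the Picard iteration for the
  linear Volterra equation
  \<open>u(r) = 1 - r\<^sup>3/2 + \<integral>\<^sub>0\<^sup>r k(s,r) u(s) ds\<close>, whose kernel \<open>k = (1 + s) \<lambda> + \<partial>\<^sub>s\<^sub>s \<lambda>\<close> is what two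
  integrations by parts produce from \<open>\<integral>\<^sub>0\<^sup>r \<lambda> (u'' + (1 + s) u) ds = 0\<close>; the boundary terms are
  \<open>1 - r\<^sup>3/2\<close> and \<open>- u(r)\<close>. Hence \<open>psi_radial\<close> is a fixed point
  (\<open>psi_radial_volterra\<close>). If \<open>\<bar>k\<bar> \<le> M\<close> on \<open>[-R,R]\<^sup>2\<close>, each step
  integrates the error once more, so the \<open>n\<close>-th error is at most \<open>C (M \<bar>r\<bar>)\<^sup>n / n!\<close>
  (\<open>volterra_iter_error\<close>), which tends to zero uniformly on \<open>[-R,R]\<close>.

  All integrals are pulled back to \<open>{0..1}\<close> by \<open>s = r x\<close>. This removes the orientation of
  \<open>\<integral>\<^sub>0\<^sup>r\<close> and makes the dependence on \<open>r\<close> that of a parameter under an integral over a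
  fixed interval.
\<close>

section \<open>The power series\<close>

text \<open>Boundedness for every \<open>y\<close> says that the radius of convergence is infinite: once
  \<open>(k + 2) (k + 3) \<ge> y\<^sup>2 + y\<^sup>3\<close>, the recursion makes each new \<open>\<bar>alpha k\<bar> y\<^sup>k\<close>
  at most the larger of two earlier values.\<close>

lemma alpha_power_bounded:
  fixes y :: real
  assumes "y \<ge> 0"
  shows "\<exists>B. \<forall>k. \<bar>alpha k\<bar> * y ^ k \<le> B"
proof -
  define b where "b k = \<bar>alpha k\<bar> * y ^ k" for k
  obtain N :: nat where N: "y ^ 2 + y ^ 3 \<le> real N"
    using real_arch_simple by blast
  define B where "B = Max (b ` {..N + 2})"
  have init: "b k \<le> B" if "k \<le> N + 2" for k
    unfolding B_def using that by (intro Max_ge) auto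
  have "b k \<le> B" for k
  proof (induction k rule: less_induct)
    case (less k)
    show ?case
    proof (cases "k \<le> N + 2")
      case False
      then obtain j where j: "k = Suc (Suc (Suc j))" "j \<ge> N"
        using le_Suc_ex[of "N + 3" k] by (auto simp: numeral_eq_Suc)
      let ?d = "(real j + 2) * (real j + 3)"
      have d: "?d > 0" by simp
      have "b j \<ge> 0" using assms by (simp add: b_def)
      have bj: "b j \<le> B" "b (Suc j) \<le> B" using less j by simp_all
      then have "B \<ge> 0" using \<open>b j \<ge> 0\<close> by linarith
      have Nd: "y ^ 2 + y ^ 3 \<le> ?d"
      proof -
        have "real N \<le> real j" using j by simp
        also have "real j \<le> ?d" by (simp add: algebra_simps)
        finally show ?thesis using N by linarith
      qed
      have "b k = \<bar>alpha (Suc j) + alpha j\<bar> * y ^ k / ?d"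
        using d by (simp add: b_def j(1) abs_mult abs_divide abs_minus_commute)
          (simp add: abs_if)
      also have "\<dots> \<le> (\<bar>alpha (Suc j)\<bar> + \<bar>alpha j\<bar>) * y ^ k / ?d"
        using assms d by (intro divide_right_mono mult_right_mono abs_triangle_ineq) auto
      also have "\<dots> = (y ^ 2 * b (Suc j) + y ^ 3 * b j) / ?d"
        by (simp add: b_def j(1) algebra_simps power2_eq_square power3_eq_cube)
      also have "\<dots> \<le> (y ^ 2 * B + y ^ 3 * B) / ?d"
        using assms bj d by (intro divide_right_mono add_mono mult_left_mono) auto
      also have "\<dots> = (y ^ 2 + y ^ 3) * B / ?d" by (simp add: algebra_simps)
      also have "\<dots> \<le> ?d * B / ?d"
        using Nd \<open>B \<ge> 0\<close> d by (intro divide_right_mono mult_right_mono) auto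
      also have "\<dots> = B" using d by simp
      finally show ?thesis .
    qed (use init in auto)
  qed
  then show ?thesis unfolding b_def by blast
qed

lemma summable_alpha_power: "summable (\<lambda>k. alpha k * x ^ k)"
proof -
  \<comment> \<open>A bound at twice the radius gives geometric decay with ratio \<open>1/2\<close>.\<close>
  obtain B where B: "\<And>k. \<bar>alpha k\<bar> * (2 * \<bar>x\<bar>) ^ k \<le> B"
    using alpha_power_bounded[of "2 * \<bar>x\<bar>"] by auto
  show ?thesis
  proof (rule summable_comparison_test)
    show "summable (\<lambda>k. B * (1 / 2 :: real) ^ k)"
      by (intro summable_mult summable_geometric) auto
    have "norm (alpha k * x ^ k) \<le> B * (1 / 2) ^ k" for k
    proof -
      have "norm (alpha k * x ^ k) = (\<bar>alpha k\<bar> * (2 * \<bar>x\<bar>) ^ k) * (1 / 2) ^ k"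
        by (simp add: abs_mult power_abs power_mult_distrib power_divide)
      also have "\<dots> \<le> B * (1 / 2) ^ k" by (intro mult_right_mono B) auto
      finally show ?thesis .
    qed
    then show "\<exists>N. \<forall>k\<ge>N. norm (alpha k * x ^ k) \<le> B * (1 / 2) ^ k" by blast
  qed
qed

definition psi_radial :: "real \<Rightarrow> real" where
  "psi_radial r = (\<Sum>k. alpha k * r ^ k)"

definition psi_radial' :: "real \<Rightarrow> real" where
  "psi_radial' r = (\<Sum>k. diffs alpha k * r ^ k)"

lemma psi_eq: "psi = (\<lambda>r t. exp (\<i> * complex_of_real t) * complex_of_real (psi_radial r))"
  by (intro ext) (simp only: psi_def psi_radial_def suminf_of_real[OF summable_alpha_power])

lemma psi_radial_deriv: "(psi_radial has_real_derivative psi_radial' r) (at r)"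
  unfolding psi_radial_def psi_radial'_def
  by (rule termdiffs_strong_converges_everywhere) (rule summable_alpha_power)

lemma diffs_diffs_alpha:
  "diffs (diffs alpha) 0 = - alpha 0"
  "diffs (diffs alpha) (Suc k) = - (alpha (Suc k) + alpha k)"
proof -
  show "diffs (diffs alpha) 0 = - alpha 0" by (simp add: diffs_def numeral_eq_Suc)
  have "diffs (diffs alpha) (Suc k) =
      (real k + 2) * (real k + 3) * alpha (Suc (Suc (Suc k)))"
    by (simp add: diffs_def add.commute del: alpha.simps)
  moreover have "(real k + 2) * (real k + 3) \<noteq> 0" by simp
  ultimately show "diffs (diffs alpha) (Suc k) = - (alpha (Suc k) + alpha k)"
    by (simp only: alpha.simps times_divide_eq_right) (erule nonzero_mult_div_cancel_left)
qed

lemma psi_radial'_deriv: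
  "(psi_radial' has_real_derivative - (1 + r) * psi_radial r) (at r)"
proof -
  let ?d = "\<lambda>k. diffs (diffs alpha) k * r ^ k"
  have a: "(\<lambda>k. alpha k * r ^ k) sums psi_radial r"
    unfolding psi_radial_def by (rule summable_sums) (rule summable_alpha_power)
  have shifted: "(\<lambda>k. alpha (Suc k) * r ^ Suc k) sums (psi_radial r - 1)"
    using a sums_Suc_iff[of "\<lambda>k. alpha k * r ^ k" "psi_radial r - 1"] by simp
  have "(\<lambda>k. - (alpha (Suc k) * r ^ Suc k) - r * (alpha k * r ^ k))
          sums (- (psi_radial r - 1) - r * psi_radial r)"
    by (intro sums_diff sums_minus sums_mult shifted a)
  moreover have "- (alpha (Suc k) * r ^ Suc k) - r * (alpha k * r ^ k) = ?d (Suc k)" for k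
    by (simp add: diffs_diffs_alpha algebra_simps)
  ultimately have "(\<lambda>k. ?d (Suc k)) sums (- (psi_radial r - 1) - r * psi_radial r)"
    by simp
  then have "?d sums (- (psi_radial r - 1) - r * psi_radial r + ?d 0)"
    by (rule sums_Suc)
  then have "(\<Sum>k. ?d k) = - (1 + r) * psi_radial r"
    by (subst (asm) diffs_diffs_alpha(1)) (auto dest!: sums_unique[symmetric] simp: algebra_simps)
  moreover have "(psi_radial' has_real_derivative (\<Sum>k. ?d k)) (at r)"
    unfolding psi_radial'_def
    by (intro termdiffs_strong_converges_everywhere termdiff_converges_all summable_alpha_power)
  ultimately show ?thesis by simp
qed

lemma psi_radial_0: "psi_radial 0 = 1" and psi_radial'_0: "psi_radial' 0 = 0"
  by (simp_all add: psi_radial_def psi_radial'_def diffs_def)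

lemma continuous_on_psi_radial: "continuous_on S psi_radial"
  by (meson DERIV_continuous_on DERIV_subset psi_radial_deriv subset_UNIV)

section \<open>The initial value problem\<close>

lemma partial_t_separated:
  "partial_t (\<lambda>r t. c * exp (\<i> * complex_of_real t) * g r) =
     (\<lambda>r t. (c * \<i>) * exp (\<i> * complex_of_real t) * g r)"
proof (intro ext)
  fix r t :: real
  have "((\<lambda>t. c * exp (\<i> * complex_of_real t) * g r) has_vector_derivative
      (c * \<i>) * exp (\<i> * complex_of_real t) * g r) (at t)"
    by (auto intro!: derivative_eq_intros has_vector_derivative_real_field)
  then show "partial_t (\<lambda>r t. c * exp (\<i> * complex_of_real t) * g r) r t =
      (c * \<i>) * exp (\<i> * complex_of_real t) * g r"
    unfolding partial_t_def by (rule vector_derivative_at)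
qed

lemma partial_tt_separated:
  "partial_t (partial_t (\<lambda>r t. exp (\<i> * complex_of_real t) * g r)) =
     (\<lambda>r t. - (exp (\<i> * complex_of_real t) * g r))"
  using partial_t_separated[of 1 g] partial_t_separated[of \<i> g] by simp

lemma separated_has_partial_r:
  assumes "\<And>r. (g has_real_derivative g' r) (at r)"
  shows "((\<lambda>r. E * complex_of_real (g r)) has_vector_derivative E * complex_of_real (g' r)) (at r)"
  using assms[of r]
  by (auto intro!: has_vector_derivative_mult_right has_vector_derivative_of_real
      simp: has_real_derivative_iff_has_vector_derivative)

lemma partial_r_separated:
  assumes "\<And>r. (g has_real_derivative g' r) (at r)"
  shows "partial_r (\<lambda>r t. E t * complex_of_real (g r)) = (\<lambda>r t. E t * complex_of_real (g' r))"
  unfolding partial_r_def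
  by (intro ext vector_derivative_at separated_has_partial_r assms)

lemma solves_ivp_psi: "solves_ivp psi"
proof -
  let ?E = "\<lambda>t. exp (\<i> * complex_of_real t)"
  have r1: "partial_r psi = (\<lambda>r t. ?E t * complex_of_real (psi_radial' r))"
    unfolding psi_eq by (rule partial_r_separated) (rule psi_radial_deriv)
  have r2: "partial_r (partial_r psi) =
      (\<lambda>r t. ?E t * complex_of_real (- (1 + r) * psi_radial r))"
    unfolding r1 by (rule partial_r_separated) (rule psi_radial'_deriv)
  have t1: "partial_t psi = (\<lambda>r t. \<i> * ?E t * complex_of_real (psi_radial r))"
    unfolding psi_eq using partial_t_separated[of 1] by simp
  have t2: "partial_t (partial_t psi) = (\<lambda>r t. - (?E t * complex_of_real (psi_radial r)))"
    unfolding psi_eq by (rule partial_tt_separated)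
  have dt: "(\<lambda>x. c * ?E x * d) differentiable (at t)" for c d t
    by (rule differentiableI_vector)
       (auto intro!: derivative_eq_intros has_vector_derivative_real_field)
  show ?thesis
    unfolding solves_ivp_def
  proof (intro conjI allI)
    fix r t :: real
    show "(\<lambda>x. psi x t) differentiable (at r)"
      unfolding psi_eq
      by (rule differentiableI_vector) (rule separated_has_partial_r, rule psi_radial_deriv)
    show "(\<lambda>x. partial_r psi x t) differentiable (at r)"
      unfolding r1
      by (rule differentiableI_vector) (rule separated_has_partial_r, rule psi_radial'_deriv)
    show "(\<lambda>x. psi r x) differentiable (at t)"
      unfolding psi_eq using dt[of 1] by (simp only: mult_1)
    show "(\<lambda>x. partial_t psi r x) differentiable (at t)"
      unfolding t1 by (rule dt)
    show "partial_r (partial_r psi) r t - partial_t (partial_t psi) r t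
            + complex_of_real r * psi r t = 0"
      unfolding r2 t2 by (simp add: psi_eq algebra_simps)
    show "psi 0 t = ?E t" by (simp add: psi_eq psi_radial_0)
    show "partial_r psi 0 t = 0" by (simp add: r1 psi_radial'_0)
  qed
qed

section \<open>The Volterra equation\<close>

definition volterra_kernel :: "real \<Rightarrow> real \<Rightarrow> real" where
  "volterra_kernel s r = (s - r) ^ 2 - r * s / 6 * (s - r) ^ 3 + lam s r"

primrec volterra_iter :: "nat \<Rightarrow> real \<Rightarrow> real" where
  "volterra_iter 0 = (\<lambda>r. 1)"
| "volterra_iter (Suc n) = (\<lambda>r. 1 - r ^ 3 / 2
     + integral {0..1} (\<lambda>x. r * (volterra_kernel (r * x) r * volterra_iter n (r * x))))"

lemma continuous_on_volterra_kernel [continuous_intros]: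
  assumes "continuous_on S f" "continuous_on S g"
  shows "continuous_on S (\<lambda>x. volterra_kernel (f x) (g x))"
  unfolding volterra_kernel_def lam_def by (intro continuous_intros assms) auto

lemma continuous_on_volterra_iter: "continuous_on UNIV (volterra_iter n)"
proof (induction n)
  case (Suc n)
  have "continuous_on (UNIV \<times> cbox 0 1)
      (\<lambda>(r, x). r * (volterra_kernel (r * x) r * volterra_iter n (r * x)))"
    unfolding case_prod_unfold
    by (intro continuous_intros continuous_on_compose2[OF Suc]) auto
  then have "continuous_on UNIV
      (\<lambda>r. integral (cbox 0 1) (\<lambda>x. r * (volterra_kernel (r * x) r * volterra_iter n (r * x))))"
    by (rule integral_continuous_on_param)
  then show ?case
    by (auto intro!: continuous_intros)
qed auto

text \<open>Both sides are \<open>G(r) - G(0)\<close> for a primitive \<open>G\<close> of \<open>g\<close>, whatever the sign of \<open>r\<close>.\<close>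

lemma has_integral_pullback:
  fixes g :: "real \<Rightarrow> real"
  assumes "continuous_on UNIV g"
  shows "((\<lambda>x. r * g (r * x)) has_integral (LBINT s=ereal 0..ereal r. g s)) {0..1}"
proof -
  define G where "G y = (LBINT s=ereal 0..ereal y. g s)" for y
  \<comment> \<open>The interval is widened by \<open>1\<close> so that every \<open>r x\<close> is an interior point of it.\<close>
  let ?a = "- \<bar>r\<bar> - 1" and ?b = "\<bar>r\<bar> + 1"
  have G: "(G has_vector_derivative g y) (at y within {?a..?b})" if "y \<in> {?a..?b}" for y
    unfolding G_def using that assms
    by (intro interval_integral_FTC2[where a = ?a and b = ?b])
       (auto intro: continuous_on_subset)
  have "((\<lambda>x. r * g (r * x)) has_integral (G (r * 1) - G (r * 0))) {0..1}"
  proof (rule fundamental_theorem_of_calculus)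
    fix x :: real assume x: "x \<in> {0..1}"
    have "\<bar>r * x\<bar> \<le> \<bar>r\<bar> * 1" unfolding abs_mult using x by (intro mult_left_mono) auto
    then have "?a < r * x" "r * x < ?b" by linarith+
    then have "(G has_real_derivative g (r * x)) (at (r * x))"
      using G[of "r * x"] at_within_Icc_at[of ?a "r * x" ?b]
      by (simp add: has_real_derivative_iff_has_vector_derivative)
    then have "((\<lambda>x. G (r * x)) has_real_derivative g (r * x) * r) (at x)"
      by (rule DERIV_chain2) (auto intro!: derivative_eq_intros)
    then show "((\<lambda>x. G (r * x)) has_vector_derivative r * g (r * x)) (at x within {0..1})"
      by (simp add: has_real_derivative_iff_has_vector_derivative[symmetric] mult.commute
          has_field_derivative_at_within)
  qed simp
  then show ?thesis by (simp add: G_def zero_ereal_def)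
qed

lemma separated_integral:
  fixes k u :: "real \<Rightarrow> real"
  shows "(LBINT s=a..b. complex_of_real (k s) * (E * complex_of_real (u s))) =
    E * complex_of_real (LBINT s=a..b. k s * u s)"
proof -
  have "(LBINT s=a..b. complex_of_real (k s) * (E * complex_of_real (u s))) =
      (LBINT s=a..b. E * complex_of_real (k s * u s))"
    by (simp add: mult_ac)
  then show ?thesis
    by (simp only: interval_lebesgue_integral_mult_right interval_lebesgue_integral_of_real)
qed

lemma psi_iter_eq:
  "psi_iter n = (\<lambda>r t. exp (\<i> * complex_of_real t) * complex_of_real (volterra_iter n r))"
proof (induction n)
  case (Suc n)
  let ?u = "volterra_iter n"
  show ?case
  proof (intro ext)
    fix r t :: real
    let ?I = "\<lambda>k. LBINT s=ereal 0..ereal r. k s * ?u s"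
    let ?k1 = "\<lambda>s. (s - r) ^ 2" and ?k2 = "\<lambda>s. r * s / 6 * (s - r) ^ 3" and ?k3 = "\<lambda>s. lam s r"
    have int: "((\<lambda>x. r * (k (r * x) * ?u (r * x))) has_integral ?I k) {0..1}"
      if "continuous_on UNIV k" for k
      by (rule has_integral_pullback)
         (intro continuous_intros that continuous_on_volterra_iter)
    have "((\<lambda>x. r * (?k1 (r * x) * ?u (r * x)) - r * (?k2 (r * x) * ?u (r * x))
          + r * (?k3 (r * x) * ?u (r * x))) has_integral ?I ?k1 - ?I ?k2 + ?I ?k3) {0..1}"
      by (intro has_integral_add has_integral_diff int)
         (auto intro!: continuous_intros simp: lam_def)
    then have eq: "integral {0..1} (\<lambda>x. r * (volterra_kernel (r * x) r * ?u (r * x))) =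
        ?I ?k1 - ?I ?k2 + ?I ?k3"
      by (intro integral_unique) (simp add: volterra_kernel_def algebra_simps)
    have tt: "partial_t (partial_t (psi_iter n)) s t =
        exp (\<i> * complex_of_real t) * complex_of_real (- ?u s)" for s
      unfolding Suc partial_tt_separated by simp
    \<comment> \<open>The sign from \<open>\<partial>\<^sub>t\<^sub>t\<close> cancels the minus in front of the \<open>\<lambda>\<close>-integral, so that
      \<open>\<lambda>\<close> enters the kernel with a plus sign.\<close>
    have neg: "(LBINT s=ereal 0..ereal r. lam s r * - ?u s) = - ?I ?k3"
      by (simp add: interval_lebesgue_integral_uminus)
    show "psi_iter (Suc n) r t =
        exp (\<i> * complex_of_real t) * complex_of_real (volterra_iter (Suc n) r)"
      unfolding psi_iter.simps volterra_iter.simps tt eq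
      by (simp only: Suc separated_integral neg) (simp add: algebra_simps)
  qed
qed simp

text \<open>The two integrations by parts amount to one primitive: along \<open>s = r x\<close>, the function
  \<open>(\<partial>\<^sub>s \<lambda>) u - \<lambda> u'\<close> has derivative \<open>r (\<partial>\<^sub>s\<^sub>s \<lambda> u - \<lambda> u'')\<close>, which is \<open>r k u\<close> because
  \<open>u'' = - (1 + s) u\<close>. Its value at \<open>s = r\<close> is \<open>u(r)\<close>, since there \<open>\<lambda> = 0\<close> and
  \<open>\<partial>\<^sub>s \<lambda> = 1\<close>; its value at \<open>s = 0\<close> is \<open>1 - r\<^sup>3/2\<close>, since \<open>u(0) = 1\<close> and \<open>u'(0) = 0\<close>.\<close>

lemma psi_radial_volterra:
  "((\<lambda>x. r * (volterra_kernel (r * x) r * psi_radial (r * x))) has_integral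
     psi_radial r - (1 - r ^ 3 / 2)) {0..1}"
proof -
  define H where "H x = (1 - r / 2 * (r * x - r) ^ 2) * psi_radial (r * x)
      - lam (r * x) r * psi_radial' (r * x)" for x
  have "((\<lambda>x. r * (volterra_kernel (r * x) r * psi_radial (r * x))) has_integral H 1 - H 0) {0..1}"
  proof (rule fundamental_theorem_of_calculus)
    fix x :: real
    have f: "((\<lambda>x. psi_radial (r * x)) has_real_derivative psi_radial' (r * x) * r) (at x)"
      by (rule DERIV_chain2[OF psi_radial_deriv]) (auto intro!: derivative_eq_intros)
    have f': "((\<lambda>x. psi_radial' (r * x)) has_real_derivative
        - (1 + r * x) * psi_radial (r * x) * r) (at x)"
      by (rule DERIV_chain2[OF psi_radial'_deriv]) (auto intro!: derivative_eq_intros)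
    have "(H has_real_derivative r * (volterra_kernel (r * x) r * psi_radial (r * x))) (at x)"
      unfolding H_def lam_def volterra_kernel_def
      by (rule derivative_eq_intros f f' refl | simp)+
         (simp add: field_simps power2_eq_square power3_eq_cube)
    then show "(H has_vector_derivative r * (volterra_kernel (r * x) r * psi_radial (r * x)))
        (at x within {0..1})"
      by (simp add: has_real_derivative_iff_has_vector_derivative[symmetric]
          has_field_derivative_at_within)
  qed simp
  moreover have "H 1 - H 0 = psi_radial r - (1 - r ^ 3 / 2)"
    by (simp add: H_def lam_def psi_radial_0 psi_radial'_0 power2_eq_square power3_eq_cube)
  ultimately show ?thesis by simp
qed

section \<open>Convergence\<close>

lemma continuous_on_compact_abs_bound:
  fixes f :: "'a::topological_space \<Rightarrow> real"
  assumes "compact S" "continuous_on S f"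
  obtains B where "\<And>x. x \<in> S \<Longrightarrow> \<bar>f x\<bar> \<le> B"
proof -
  have "bounded (f ` S)"
    using assms by (intro compact_imp_bounded compact_continuous_image)
  then obtain B where "\<forall>x\<in>S. \<bar>f x\<bar> \<le> B" by (auto simp: bounded_iff)
  then show thesis by (intro that) blast
qed

lemma volterra_kernel_bounded: "\<exists>M\<ge>0. \<forall>s\<in>{-R..R}. \<forall>r\<in>{-R..R}. \<bar>volterra_kernel s r\<bar> \<le> M"
proof -
  obtain M where M: "\<And>p. p \<in> {-R..R} \<times> {-R..R} \<Longrightarrow> \<bar>volterra_kernel (fst p) (snd p)\<bar> \<le> M"
    by (rule continuous_on_compact_abs_bound
        [of "{-R..R} \<times> {-R..R}" "\<lambda>p. volterra_kernel (fst p) (snd p)"])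
       (auto intro!: continuous_intros compact_Times)
  have "\<bar>volterra_kernel s r\<bar> \<le> max M 0" if "s \<in> {-R..R}" "r \<in> {-R..R}" for s r
    using M[of "(s, r)"] that by auto
  then show ?thesis by (intro exI[of _ "max M 0"]) auto
qed

text \<open>The factor \<open>\<bar>r\<bar> x\<^sup>n\<close> in the pulled-back integrand is what produces the next factorial:
  \<open>\<bar>r\<bar> M (M \<bar>r\<bar>)\<^sup>n / n! \<integral>\<^sub>0\<^sup>1 x\<^sup>n dx = (M \<bar>r\<bar>)\<^sup>n\<^sup>+\<^sup>1 / (n + 1)!\<close>. The induction stays inside
  \<open>[-R,R]\<close> because \<open>\<bar>r x\<bar> \<le> \<bar>r\<bar>\<close>.\<close>

lemma volterra_iter_error:
  assumes M: "M \<ge> 0" "\<And>s r. s \<in> {-R..R} \<Longrightarrow> r \<in> {-R..R} \<Longrightarrow> \<bar>volterra_kernel s r\<bar> \<le> M"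
    and C: "\<And>r. r \<in> {-R..R} \<Longrightarrow> \<bar>1 - psi_radial r\<bar> \<le> C"
    and r: "r \<in> {-R..R}"
  shows "\<bar>volterra_iter n r - psi_radial r\<bar> \<le> C * ((M * \<bar>r\<bar>) ^ n / fact n)"
  using r
proof (induction n arbitrary: r)
  case (Suc n)
  let ?e = "\<lambda>s. volterra_iter n s - psi_radial s"
  let ?F = "\<lambda>x. r * (volterra_kernel (r * x) r * ?e (r * x))"
  let ?B = "\<lambda>x. C * (M * \<bar>r\<bar>) ^ Suc n / fact n * x ^ n"
  have "(\<lambda>x. r * (volterra_kernel (r * x) r * volterra_iter n (r * x))) integrable_on {0..1}"
    by (intro integrable_continuous_real continuous_intros
        continuous_on_compose2[OF continuous_on_volterra_iter]) auto
  then have "((\<lambda>x. r * (volterra_kernel (r * x) r * volterra_iter n (r * x))) has_integral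
      volterra_iter (Suc n) r - (1 - r ^ 3 / 2)) {0..1}"
    by (simp add: has_integral_integral)
  from has_integral_diff[OF this psi_radial_volterra[of r]]
  have F: "(?F has_integral volterra_iter (Suc n) r - psi_radial r) {0..1}"
    by (simp add: algebra_simps)
  have B: "(?B has_integral C * ((M * \<bar>r\<bar>) ^ Suc n / fact (Suc n))) {0..1}"
  proof -
    have deriv: "((\<lambda>x. x ^ Suc n / Suc n) has_real_derivative x ^ n) (at x within {0..1})" for x
      using DERIV_cdivide[OF DERIV_pow[of "Suc n" x "{0..1}"], of "real (Suc n)"]
      by (simp del: of_nat_Suc power_Suc)
    have "((\<lambda>x::real. x ^ n) has_integral 1 ^ Suc n / Suc n - 0 ^ Suc n / Suc n) {0..1}"
      by (rule fundamental_theorem_of_calculus)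
         (simp_all only: deriv zero_le_one
            flip: has_real_derivative_iff_has_vector_derivative)
    from has_integral_mult_right[OF this, of "C * (M * \<bar>r\<bar>) ^ Suc n / fact n"]
    show ?thesis by (simp add: field_simps)
  qed
  have "norm (?F x) \<le> ?B x" if x: "x \<in> {0..1}" for x
  proof -
    have "\<bar>r * x\<bar> \<le> \<bar>r\<bar> * 1" unfolding abs_mult using x by (intro mult_left_mono) auto
    then have rx: "r * x \<in> {-R..R}" using Suc.prems by auto
    have "norm (?F x) = \<bar>r\<bar> * (\<bar>volterra_kernel (r * x) r\<bar> * \<bar>?e (r * x)\<bar>)" by (simp add: abs_mult)
    also have "\<dots> \<le> \<bar>r\<bar> * (M * (C * ((M * \<bar>r * x\<bar>) ^ n / fact n)))"
      using M(1) by (intro mult_left_mono mult_mono M(2) Suc.IH rx Suc.prems) auto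
    also have "\<dots> = ?B x" using x by (simp add: abs_mult power_mult_distrib field_simps)
    finally show ?thesis .
  qed
  then have "norm (integral {0..1} ?F) \<le> integral {0..1} ?B"
    using F B by (intro integral_norm_bound_integral) (auto simp: has_integral_iff)
  then show ?case using F B by (simp add: has_integral_iff)
qed (use C in auto)

lemma volterra_iter_uniform_limit:
  "uniform_limit {-R..R} volterra_iter psi_radial sequentially"
proof -
  obtain M where M: "M \<ge> 0" "\<And>s r. s \<in> {-R..R} \<Longrightarrow> r \<in> {-R..R} \<Longrightarrow> \<bar>volterra_kernel s r\<bar> \<le> M"
    using volterra_kernel_bounded[of R] by blast
  obtain C where C: "\<And>r. r \<in> {-R..R} \<Longrightarrow> \<bar>1 - psi_radial r\<bar> \<le> C"
    by (rule continuous_on_compact_abs_bound[of "{-R..R}" "\<lambda>r. 1 - psi_radial r"])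
       (auto intro!: continuous_intros continuous_on_psi_radial)
  let ?b = "\<lambda>n. C * ((M * R) ^ n / fact n)"
  have bound: "\<bar>volterra_iter n r - psi_radial r\<bar> \<le> ?b n" if r: "r \<in> {-R..R}" for n r
  proof -
    have "C \<ge> 0" using C[OF r] by linarith
    have "\<bar>volterra_iter n r - psi_radial r\<bar> \<le> C * ((M * \<bar>r\<bar>) ^ n / fact n)"
      using M C r by (rule volterra_iter_error)
    also have "\<dots> \<le> ?b n"
      using r M(1) \<open>C \<ge> 0\<close>
      by (intro mult_left_mono divide_right_mono power_mono) auto
    finally show ?thesis .
  qed
  have "(\<lambda>n. (M * R) ^ n / fact n) \<longlonglongrightarrow> 0"
    using summable_LIMSEQ_zero[OF summable_exp[of "M * R"]] by (simp add: field_simps)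
  then have "?b \<longlonglongrightarrow> 0" by (rule tendsto_mult_right_zero)
  show ?thesis
  proof (rule uniform_limitI)
    fix e :: real assume "e > 0"
    from order_tendstoD(2)[OF \<open>?b \<longlonglongrightarrow> 0\<close> this]
    show "\<forall>\<^sub>F n in sequentially. \<forall>r\<in>{-R..R}. dist (volterra_iter n r) (psi_radial r) < e"
    proof eventually_elim
      case (elim n)
      show ?case
        using bound[of _ n] elim unfolding dist_real_def by (meson le_less_trans)
    qed
  qed
qed

theorem theorem4p5:
  "solves_ivp psi \<and>
   (\<forall>R::real. R > 0 \<longrightarrow> (\<forall>t::real.
      uniform_limit {-R..R} (\<lambda>n r. psi_iter n r t) (\<lambda>r. psi r t) sequentially))"
proof (intro conjI allI impI)
  fix R t :: real
  have "dist (psi_iter n r t) (psi r t) = dist (volterra_iter n r) (psi_radial r)" for n r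
  proof -
    have "psi_iter n r t - psi r t =
        exp (\<i> * complex_of_real t) * complex_of_real (volterra_iter n r - psi_radial r)"
      by (simp add: psi_iter_eq psi_eq algebra_simps)
    then show ?thesis
      by (simp only: dist_norm norm_mult norm_of_real norm_exp_i_times real_norm_def mult_1)
  qed
  then show "uniform_limit {-R..R} (\<lambda>n r. psi_iter n r t) (\<lambda>r. psi r t) sequentially"
    using volterra_iter_uniform_limit[of R] by (simp add: uniform_limit_iff)
qed (rule solves_ivp_psi)

end
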